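(* Let $M$ be a matroid (possibly infinite). Any two $\mathbb{F}_3$-paintings of $M$ are equivalent.
   Context: Matroids may be infinite, in the following sense: a matroid on a set $E$ is given by a family $\mathcal{I}\subseteq\mathcal{P}(E)$ of independent sets such that (I1) $\emptyset\in\mathcal{I}$; (I2) $\mathcal{I}$ is closed under subsets; (I3) whenever $I,I'\in\mathcal{I}$ with $I'$ maximal and $I$ not maximal, there is $x\in I'\setminus I$ with $I\cup\{x\}\in\mathcal{I}$; (IM) whenever $I\subseteq X\subseteq E$ and $I\in\mathcal{I}$, the set $\{I'\in\mathcal{I}\mid I\subseteq I'\subseteq X\}$ has a maximal element. Circuits are minimal dependent sets; the dual $M^*$ has as bases (maximal independent sets) the complements of bases of $M$, and cocircuits of $M$ are circuits of $M^*$. $\mathcal{C}(M)$ and $\mathcal{C}(M^* )$ denote the sets of circuits and cocircuits of $M$. Let $k$ be a field with set of nonzero elements $k^*$. A $k$-painting of $M$ is a choice of a function $c_o\colon o\to k^*$ for each $o\in\mathcal{C}(M)$ and a function $d_b\colon b\to k^*$ for each $b\in\mathcal{C}(M^* )$ such that for every $o\in\mathcal{C}(M)$ and $b\in\mathcal{C}(M^* )$ we have $\sum_{e\in o\cap b}c_o(e)d_b(e)=0$, where this equation includes the requirement that only finitely many summands are nonzero (so that $o\cap b$ is finite). Two $k$-paintings $((c_o\mid o\in\mathcal{C}(M)),(d_b\mid b\in\mathcal{C}(M^* )))$ and $((\tilde c_o\mid o\in\mathcal{C}(M)),(\tilde d_b\mid b\in\mathcal{C}(M^* )))$ of $M$ are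 equivalent if and only if there are constants $x(o)\in k^*$ for every $o\in\mathcal{C}(M)$, $x(b)\in k^*$ for every $b\in\mathcal{C}(M^* )$, $x(e)\in k^*$ for every $e\in E$, and a field automorphism $\varphi$ of $k$ such that $\tilde c_o(e)=\varphi(x(o)x(e)c_o(e))$ for all $e\in o\in\mathcal{C}(M)$, and $\tilde d_b(e)=\varphi\left(\frac{x(b)d_b(e)}{x(e)}\right)$ for all $e\in b\in\mathcal{C}(M^* )$. (The constants attached to circuits, to cocircuits and to edges are three separate families.) *)

theory Defs
  imports "HOL-Library.Cardinality"
begin

definition maximal_in :: "'a set set \<Rightarrow> 'a set \<Rightarrow> bool" where
  "maximal_in F X \<longleftrightarrow> X \<in> F \<and> (\<forall>Y\<in>F. X \<subseteq> Y \<longrightarrow> Y = X)"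

definition minimal_in :: "'a set set \<Rightarrow> 'a set \<Rightarrow> bool" where
  "minimal_in F X \<longleftrightarrow> X \<in> F \<and> (\<forall>Y\<in>F. Y \<subseteq> X \<longrightarrow> Y = X)"

text \<open>
  Neither the ground set \<open>E\<close> nor the members of \<open>\<I>\<close> (the independent sets) need be finite.
\<close>

locale matroid =
  fixes E :: "'a set" and \<I> :: "'a set set"
  assumes indep_subset_carrier: "\<I> \<subseteq> Pow E"
    and I1: "{} \<in> \<I>"
    and I2: "J \<in> \<I> \<Longrightarrow> I \<subseteq> J \<Longrightarrow> I \<in> \<I>"
    and I3: "I \<in> \<I> \<Longrightarrow> \<not> maximal_in \<I> I \<Longrightarrow> maximal_in \<I> I' \<Longrightarrow>
               \<exists>x\<in>I' - I. I \<union> {x} \<in> \<I>"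
    and IM: "I \<in> \<I> \<Longrightarrow> I \<subseteq> X \<Longrightarrow> X \<subseteq> E \<Longrightarrow>
               \<exists>B. maximal_in {I' \<in> \<I>. I \<subseteq> I' \<and> I' \<subseteq> X} B"

definition bases :: "'a set set \<Rightarrow> 'a set set" where
  "bases \<I> = {B. maximal_in \<I> B}"

definition circuits :: "'a set \<Rightarrow> 'a set set \<Rightarrow> 'a set set" where
  "circuits E \<I> = {C. minimal_in (Pow E - \<I>) C}"

text \<open>
  The independent sets of the dual matroid: the subsets of complements of bases.
  The lemma after the definition confirms that its bases are the complements of bases.
\<close>

definition dual_indep :: "'a set \<Rightarrow> 'a set set \<Rightarrow> 'a set set" where
  "dual_indep E \<I> = {J. \<exists>B\<in>bases \<I>. J \<subseteq> E - B}"

lemma (in matroid) bases_dual_indep: "bases (dual_indep E \<I>) = (\<lambda>B. E - B) ` bases \<I>"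
proof (intro equalityI subsetI)
  fix D assume D: "D \<in> bases (dual_indep E \<I>)"
  then obtain B where B: "B \<in> bases \<I>" "D \<subseteq> E - B"
    by (auto simp: bases_def maximal_in_def dual_indep_def)
  then have "E - B \<in> dual_indep E \<I>"
    by (auto simp: dual_indep_def)
  with D B have "E - B = D"
    by (simp add: bases_def maximal_in_def)
  with B show "D \<in> (\<lambda>B. E - B) ` bases \<I>"
    by blast
next
  fix D assume "D \<in> (\<lambda>B. E - B) ` bases \<I>"
  then obtain B where B: "B \<in> bases \<I>" and D: "D = E - B"
    by blast
  have "J = D" if "J \<in> dual_indep E \<I>" "D \<subseteq> J" for J
  proof -
    from that obtain B' where B': "B' \<in> bases \<I>" "J \<subseteq> E - B'"
      by (auto simp: dual_indep_def)
    have "B' \<subseteq> E"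
      using B' indep_subset_carrier by (auto simp: bases_def maximal_in_def)
    with B' that D have "B' \<subseteq> B"
      by blast
    with B B' have "B = B'"
      by (simp add: bases_def maximal_in_def)
    with B' that D show "J = D"
      by blast
  qed
  with B D show "D \<in> bases (dual_indep E \<I>)"
    by (auto simp: bases_def maximal_in_def dual_indep_def)
qed

definition cocircuits :: "'a set \<Rightarrow> 'a set set \<Rightarrow> 'a set set" where
  "cocircuits E \<I> = circuits E (dual_indep E \<I>)"

text \<open>
  A function from a circuit \<open>C\<close> to the nonzero elements of the field is a total function
  \<open>c C\<close> of which only the values on \<open>C\<close> matter; likewise for cocircuits.
  All summands below are nonzero, so requiring that only finitely many are nonzero amounts to
  finiteness of \<open>C \<inter> D\<close>; it is explicit because \<^const>\<open>sum\<close> is \<open>0\<close> over an infinite set.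
\<close>

definition painting ::
  "'a set \<Rightarrow> 'a set set \<Rightarrow> ('a set \<Rightarrow> 'a \<Rightarrow> 'k::field) \<Rightarrow> ('a set \<Rightarrow> 'a \<Rightarrow> 'k) \<Rightarrow> bool" where
  "painting E \<I> c d \<longleftrightarrow>
     (\<forall>C\<in>circuits E \<I>. \<forall>e\<in>C. c C e \<noteq> 0) \<and>
     (\<forall>D\<in>cocircuits E \<I>. \<forall>e\<in>D. d D e \<noteq> 0) \<and>
     (\<forall>C\<in>circuits E \<I>. \<forall>D\<in>cocircuits E \<I>.
        finite (C \<inter> D) \<and> (\<Sum>e\<in>C \<inter> D. c C e * d D e) = 0)"

definition field_automorphism :: "('k::field \<Rightarrow> 'k) \<Rightarrow> bool" where
  "field_automorphism \<phi> \<longleftrightarrow>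
     bij \<phi> \<and> \<phi> 1 = 1 \<and>
     (\<forall>x y. \<phi> (x + y) = \<phi> x + \<phi> y) \<and> (\<forall>x y. \<phi> (x * y) = \<phi> x * \<phi> y)"

text \<open>
  The scaling constants of circuits, cocircuits and edges are three separate families
  \<open>x\<close>, \<open>y\<close>, \<open>z\<close>, since a set may be both a circuit and a cocircuit.
\<close>

definition equivalent_paintings ::
  "'a set \<Rightarrow> 'a set set \<Rightarrow>
   ('a set \<Rightarrow> 'a \<Rightarrow> 'k::field) \<Rightarrow> ('a set \<Rightarrow> 'a \<Rightarrow> 'k) \<Rightarrow>
   ('a set \<Rightarrow> 'a \<Rightarrow> 'k) \<Rightarrow> ('a set \<Rightarrow> 'a \<Rightarrow> 'k) \<Rightarrow> bool" where
  "equivalent_paintings E \<I> c d c' d' \<longleftrightarrow>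
     (\<exists>(x :: 'a set \<Rightarrow> 'k) (y :: 'a set \<Rightarrow> 'k) (z :: 'a \<Rightarrow> 'k) \<phi>.
        (\<forall>C\<in>circuits E \<I>. x C \<noteq> 0) \<and>
        (\<forall>D\<in>cocircuits E \<I>. y D \<noteq> 0) \<and>
        (\<forall>e\<in>E. z e \<noteq> 0) \<and>
        field_automorphism \<phi> \<and>
        (\<forall>C\<in>circuits E \<I>. \<forall>e\<in>C. c' C e = \<phi> (x C * z e * c C e)) \<and>
        (\<forall>D\<in>cocircuits E \<I>. \<forall>e\<in>D. d' D e = \<phi> (y D * d D e / z e)))"

end

theory Submission
  imports Defs
begin

text \<open>
  Write \<open>\<sigma> C e = c C e * c' C e\<close> and \<open>\<tau> D e = d D e * d' D e\<close>. Over the field with three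
  elements these are signs, and the theorem asks for one sign \<open>z e\<close> per edge such that \<open>\<sigma> C\<close>
  and \<open>\<tau> D\<close> agree with \<open>z\<close> up to a global sign on each circuit \<open>C\<close> and each cocircuit \<open>D\<close>.

  The heart of the matter is that \<open>\<sigma> C e * \<tau> D e\<close> is constant on \<open>C \<inter> D\<close>, by induction on the
  size of this finite set. If it differs at \<open>p\<close> and \<open>q\<close>, both orthogonality relations force
  \<open>C \<inter> D\<close> to have at least four elements, two of each sign. In a basis \<open>B\<close> with
  \<open>B \<inter> D = {p}\<close> and \<open>C - D \<subseteq> B\<close>, the fundamental circuit of \<open>q\<close> and a cocircuit
  obtained from \<open>D\<close> by a single pivot both contain \<open>p\<close> and \<open>q\<close>, and all the intersections in
  the resulting chain from \<open>C\<close> to \<open>D\<close> are smaller. Hence the sign \<open>\<rho> e f = \<sigma> C e * \<sigma> C f\<close>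
  does not depend on the circuit \<open>C\<close> through \<open>e\<close> and \<open>f\<close>. A further pivot shows that lying on a
  common circuit is transitive, with all three edges on one circuit or one cocircuit, so \<open>\<rho>\<close> is
  multiplicative and \<open>z e = \<rho> r e\<close> works, where \<open>r\<close> represents the component of \<open>e\<close>.
\<close>

section \<open>Bases, circuits and cocircuits\<close>

lemma circuit_subset_carrier: "C \<in> circuits E \<I> \<Longrightarrow> C \<subseteq> E"
  by (auto simp: circuits_def minimal_in_def)

lemma cocircuit_subset_carrier: "D \<in> cocircuits E \<I> \<Longrightarrow> D \<subseteq> E"
  by (simp add: cocircuits_def circuit_subset_carrier)

context matroid
begin

section \<open>Bases and their extension\<close>

lemma base_indep: "B \<in> bases \<I> \<Longrightarrow> B \<in> \<I>"
  by (simp add: bases_def maximal_in_def)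

lemma base_subset_carrier: "B \<in> bases \<I> \<Longrightarrow> B \<subseteq> E"
  using base_indep indep_subset_carrier by blast

lemma base_insert_dep: "B \<in> bases \<I> \<Longrightarrow> x \<notin> B \<Longrightarrow> insert x B \<notin> \<I>"
  by (force simp: bases_def maximal_in_def)

lemma indep_augment:
  assumes "I \<in> \<I>" "I \<notin> bases \<I>" "B \<in> bases \<I>"
  obtains x where "x \<in> B - I" "insert x I \<in> \<I>"
  using I3[of I B] assms by (auto simp: bases_def)

text \<open>(IM) supplies a maximal independent set between \<open>I\<close> and \<open>X\<close>.
  If it were not a base, (I3) would add an element of \<open>B\<close>, which stays inside
  \<open>X\<close>.\<close>

lemma base_between:
  assumes I: "I \<in> \<I>" "I \<subseteq> X" and X: "B \<in> bases \<I>" "B \<subseteq> X" "X \<subseteq> E"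
  obtains J where "J \<in> bases \<I>" "I \<subseteq> J" "J \<subseteq> X"
proof -
  obtain J where J: "maximal_in {I' \<in> \<I>. I \<subseteq> I' \<and> I' \<subseteq> X} J"
    using IM[OF I X(3)] by blast
  have "J \<in> bases \<I>"
  proof (rule ccontr)
    assume "J \<notin> bases \<I>"
    then obtain x where x: "x \<in> B - J" "insert x J \<in> \<I>"
      using indep_augment[of J B] J X by (auto simp: maximal_in_def)
    then have "insert x J = J"
      using J X by (auto simp: maximal_in_def)
    with x show False by blast
  qed
  with J show thesis
    by (intro that) (auto simp: maximal_in_def)
qed

lemma base_exists: obtains B where "B \<in> bases \<I>"
proof -
  obtain B where "maximal_in {I' \<in> \<I>. {} \<subseteq> I' \<and> I' \<subseteq> E} B"
    using IM[of "{}" E] I1 by blast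
  then have "maximal_in \<I> B"
    using indep_subset_carrier by (auto simp: maximal_in_def)
  then show thesis
    by (intro that) (simp add: bases_def)
qed

lemma indep_extends_to_base:
  assumes "I \<in> \<I>"
  obtains B where "B \<in> bases \<I>" "I \<subseteq> B"
proof -
  obtain B0 where B0: "B0 \<in> bases \<I>" by (rule base_exists)
  have "I \<subseteq> E"
    using assms indep_subset_carrier by blast
  then obtain B where "B \<in> bases \<I>" "I \<subseteq> B"
    using base_between[OF assms _ B0 base_subset_carrier[OF B0] subset_refl] by metis
  then show thesis by (rule that)
qed

text \<open>If this set were not a base, it could be augmented from \<open>B\<close>; only
  \<open>f\<close> can be missing, and \<open>insert x B\<close> would be independent.\<close>

lemma base_swap:
  assumes B: "B \<in> bases \<I>" and x: "x \<notin> B" and indep: "insert x (B - {f}) \<in> \<I>"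
  shows "insert x (B - {f}) \<in> bases \<I>"
proof (rule ccontr)
  assume "\<not> ?thesis"
  from indep_augment[OF indep this B]
  obtain y where "y \<in> B - insert x (B - {f})" "insert y (insert x (B - {f})) \<in> \<I>" .
  moreover from this have "insert y (insert x (B - {f})) = insert x B"
    by auto
  ultimately show False
    using base_insert_dep[OF B x] by simp
qed

lemma circuit_nonempty: "C \<in> circuits E \<I> \<Longrightarrow> C \<noteq> {}"
  using I1 by (auto simp: circuits_def minimal_in_def)

lemma circuit_psubset_indep:
  assumes "C \<in> circuits E \<I>" "I \<subset> C"
  shows "I \<in> \<I>"
proof (rule ccontr)
  assume "I \<notin> \<I>"
  moreover have "I \<subseteq> E"
    using assms circuit_subset_carrier by blast
  ultimately have "I = C"
    using assms by (simp add: circuits_def minimal_in_def)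
  with assms show False by blast
qed

lemma cocircuit_meets_base:
  "D \<in> cocircuits E \<I> \<Longrightarrow> B \<in> bases \<I> \<Longrightarrow> D \<inter> B \<noteq> {}"
  by (auto simp: cocircuits_def circuits_def minimal_in_def dual_indep_def)

lemma cocircuit_nonempty: "D \<in> cocircuits E \<I> \<Longrightarrow> D \<noteq> {}"
  using cocircuit_meets_base base_exists by blast

lemma cocircuit_remove_avoids_base:
  assumes "D \<in> cocircuits E \<I>" "p \<in> D"
  obtains B where "B \<in> bases \<I>" "B \<inter> (D - {p}) = {}"
proof -
  have "D - {p} \<in> dual_indep E \<I>"
  proof (rule ccontr)
    assume "D - {p} \<notin> dual_indep E \<I>"
    then have "D - {p} \<in> Pow E - dual_indep E \<I>"
      using cocircuit_subset_carrier[OF assms(1)] by blast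
    with assms(1) have "D - {p} = D"
      by (simp add: cocircuits_def circuits_def minimal_in_def)
    with assms(2) show False by blast
  qed
  then show thesis
    using that by (auto simp: dual_indep_def)
qed

section \<open>Fundamental circuits and cocircuits\<close>

lemma fundamental_circuit:
  assumes B: "B \<in> bases \<I>" and y: "y \<in> E" "y \<notin> B"
  obtains C where "C \<in> circuits E \<I>" "y \<in> C" "C \<subseteq> insert y B"
proof -
  \<comment> \<open>An explicit candidate, since shrinking a dependent set to a minimal one may
    never end in an infinite matroid.\<close>
  define C where "C = {x \<in> insert y B. insert y B - {x} \<in> \<I>}"
  have yC: "y \<in> C"
    using base_indep[OF B] y by (simp add: C_def)
  have dep: "C \<notin> \<I>"
  proof
    assume "C \<in> \<I>"
    \<comment> \<open>A base \<open>J\<close> between \<open>C\<close> and \<open>insert y B\<close>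
      misses some \<open>x\<close> of \<open>B\<close>. Augmenting \<open>B - {x}\<close> from
      \<open>J\<close> can only add \<open>y\<close>, which puts \<open>x\<close> into
      \<open>C\<close>.\<close>
    then obtain J where J: "J \<in> bases \<I>" "C \<subseteq> J" "J \<subseteq> insert y B"
      using base_between[of C "insert y B" B] B y base_subset_carrier[OF B]
      by (auto simp: C_def)
    have "J \<noteq> insert y B"
      using base_indep[OF J(1)] base_insert_dep[OF B y(2)] by auto
    with J yC obtain x where x: "x \<in> B" "x \<notin> J"
      by blast
    have "B - {x} \<in> \<I>"
      using I2[OF base_indep[OF B]] by blast
    moreover have "B - {x} \<notin> bases \<I>"
      using base_insert_dep[of "B - {x}" x] x base_indep[OF B] by (auto simp: insert_absorb)
    ultimately obtain z where "z \<in> J - (B - {x})" "insert z (B - {x}) \<in> \<I>"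
      by (rule indep_augment[OF _ _ J(1)])
    moreover from this have "z = y"
      using J x by auto
    moreover have "insert y (B - {x}) = insert y B - {x}"
      using x y by auto
    ultimately have "x \<in> C"
      using x by (simp add: C_def)
    with J x show False by blast
  qed
  have "C \<in> circuits E \<I>"
    unfolding circuits_def minimal_in_def mem_Collect_eq
  proof (intro conjI ballI impI)
    show "C \<in> Pow E - \<I>"
      using dep y base_subset_carrier[OF B] by (auto simp: C_def)
    fix A assume A: "A \<in> Pow E - \<I>" "A \<subseteq> C"
    show "A = C"
    proof (rule ccontr)
      assume "A \<noteq> C"
      with A obtain x where x: "x \<in> C" "x \<notin> A"
        by blast
      then have "A \<subseteq> insert y B - {x}"
        using A by (auto simp: C_def)
      moreover have "insert y B - {x} \<in> \<I>"
        using x by (simp add: C_def)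
      ultimately show False
        using A I2 by blast
    qed
  qed
  with yC show thesis
    by (intro that) (auto simp: C_def)
qed

lemma fundamental_cocircuit:
  assumes B: "B \<in> bases \<I>" and f: "f \<in> B"
  obtains D where "D \<in> cocircuits E \<I>" "D \<inter> B = {f}"
    "\<And>x. x \<in> D \<Longrightarrow> insert x (B - {f}) \<in> bases \<I>"
proof -
  \<comment> \<open>The edges that may replace \<open>f\<close> in \<open>B\<close>. Every base
    meets \<open>D\<close> by augmenting \<open>B - {f}\<close>, and for \<open>x\<close> in
    \<open>D\<close> the rest \<open>D - {x}\<close> avoids the base
    \<open>insert x (B - {f})\<close>.\<close>
  define D where "D = {x \<in> E - (B - {f}). insert x (B - {f}) \<in> \<I>}"
  have fB: "insert f (B - {f}) = B"
    using f by auto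
  have DB: "D \<inter> B = {f}"
    using f fB base_subset_carrier[OF B] base_indep[OF B] by (auto simp: D_def)
  have base: "insert x (B - {f}) \<in> bases \<I>" if "x \<in> D" for x
  proof (cases "x = f")
    case True
    with B fB show ?thesis by metis
  next
    case False
    with that show ?thesis
      by (intro base_swap[OF B]) (auto simp: D_def)
  qed
  have indep: "B - {f} \<in> \<I>"
    using I2[OF base_indep[OF B]] by blast
  have not_base: "B - {f} \<notin> bases \<I>"
    using base_insert_dep[of "B - {f}" f] fB base_indep[OF B] by auto
  have meets: "D \<inter> B' \<noteq> {}" if B': "B' \<in> bases \<I>" for B'
  proof -
    obtain x where "x \<in> B' - (B - {f})" "insert x (B - {f}) \<in> \<I>"
      by (rule indep_augment[OF indep not_base B'])
    with base_subset_carrier[OF B'] show ?thesis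
      by (auto simp: D_def)
  qed
  have "D \<in> circuits E (dual_indep E \<I>)"
    unfolding circuits_def minimal_in_def mem_Collect_eq
  proof (intro conjI ballI impI)
    show "D \<in> Pow E - dual_indep E \<I>"
      using meets by (fastforce simp: dual_indep_def D_def)
    fix A assume A: "A \<in> Pow E - dual_indep E \<I>" "A \<subseteq> D"
    show "A = D"
    proof (rule ccontr)
      assume "A \<noteq> D"
      with A obtain x where x: "x \<in> D" "x \<notin> A"
        by blast
      then have "A \<subseteq> E - insert x (B - {f})"
        using A by (auto simp: D_def)
      then show False
        using A base[OF x(1)] by (auto simp: dual_indep_def)
    qed
  qed
  then show thesis
    using that DB base by (simp add: cocircuits_def)
qed

text \<open>\<open>C - D\<close> is independent because it misses \<open>p\<close>, so it extends to
  a base inside the complement of \<open>D - {p}\<close>. That base must meet \<open>D\<close>, and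
  can do so only in \<open>p\<close>.\<close>

lemma base_through_circuit_and_cocircuit:
  assumes C: "C \<in> circuits E \<I>" and D: "D \<in> cocircuits E \<I>" and p: "p \<in> C" "p \<in> D"
  obtains B where "B \<in> bases \<I>" "B \<inter> D = {p}" "C - D \<subseteq> B"
proof -
  obtain B0 where B0: "B0 \<in> bases \<I>" "B0 \<inter> (D - {p}) = {}"
    using cocircuit_remove_avoids_base[OF D p(2)] .
  have "C - D \<in> \<I>"
    using circuit_psubset_indep[OF C, of "C - D"] p by auto
  then obtain B where B: "B \<in> bases \<I>" "C - D \<subseteq> B" "B \<subseteq> E - (D - {p})"
    using base_between[of "C - D" "E - (D - {p})" B0] B0 base_subset_carrier[OF B0(1)]
      circuit_subset_carrier[OF C] by blast
  with cocircuit_meets_base[OF D B(1)] have "B \<inter> D = {p}"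
    by auto
  with B that show thesis by blast
qed

end

section \<open>Paintings\<close>

locale painted_matroid = matroid E \<I>
  for E :: "'a set" and \<I> :: "'a set set" +
  fixes c d :: "'a set \<Rightarrow> 'a \<Rightarrow> 'k::field"
  assumes painting: "painting E \<I> c d"
begin

text \<open>Extension by zero lets sums run over any finite set containing
  \<open>C \<inter> D\<close> and turns membership into nonvanishing.\<close>

definition cval :: "'a set \<Rightarrow> 'a \<Rightarrow> 'k" where
  "cval C e = (if e \<in> C then c C e else 0)"

definition dval :: "'a set \<Rightarrow> 'a \<Rightarrow> 'k" where
  "dval D e = (if e \<in> D then d D e else 0)"

lemma cval_eq_0_iff: "C \<in> circuits E \<I> \<Longrightarrow> cval C e = 0 \<longleftrightarrow> e \<notin> C"
  using painting by (auto simp: cval_def painting_def)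

lemma dval_eq_0_iff: "D \<in> cocircuits E \<I> \<Longrightarrow> dval D e = 0 \<longleftrightarrow> e \<notin> D"
  using painting by (auto simp: dval_def painting_def)

lemma finite_circuit_Int_cocircuit:
  "C \<in> circuits E \<I> \<Longrightarrow> D \<in> cocircuits E \<I> \<Longrightarrow> finite (C \<inter> D)"
  using painting by (simp add: painting_def)

lemma orthogonal:
  assumes C: "C \<in> circuits E \<I>" and D: "D \<in> cocircuits E \<I>"
    and S: "finite S" "C \<inter> D \<subseteq> S"
  shows "(\<Sum>e\<in>S. cval C e * dval D e) = 0"
proof -
  have "(\<Sum>e\<in>S. cval C e * dval D e) = (\<Sum>e\<in>C \<inter> D. cval C e * dval D e)"
    using S by (intro sum.mono_neutral_right) (auto simp: cval_def dval_def)
  also have "\<dots> = (\<Sum>e\<in>C \<inter> D. c C e * d D e)"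
    by (intro sum.cong) (auto simp: cval_def dval_def)
  finally show ?thesis
    using painting C D by (simp add: painting_def)
qed

lemma orthogonal_pair:
  assumes "C \<in> circuits E \<I>" "D \<in> cocircuits E \<I>" "C \<inter> D \<subseteq> {e, f}" "e \<noteq> f"
  shows "cval C e * dval D e + cval C f * dval D f = 0"
  using orthogonal[of C D "{e, f}"] assms by simp

text \<open>A single nonzero summand cannot add up to zero.\<close>

lemma other_common_element:
  assumes C: "C \<in> circuits E \<I>" and D: "D \<in> cocircuits E \<I>" and e: "e \<in> C" "e \<in> D"
  obtains f where "f \<in> C" "f \<in> D" "f \<noteq> e"
proof -
  have "\<not> C \<inter> D \<subseteq> {e}"
    using orthogonal[OF C D, of "{e}"] cval_eq_0_iff[OF C] dval_eq_0_iff[OF D] e by auto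
  with that show thesis by blast
qed

text \<open>By orthogonality the intersection is never a single edge, so it contains both
  \<open>e\<close> and \<open>f\<close> or neither.\<close>

lemma mem_circuit_iff_mem_cocircuit:
  assumes C: "C \<in> circuits E \<I>" and D: "D \<in> cocircuits E \<I>"
    and sub: "C \<inter> D \<subseteq> {e, f}" and e: "e \<in> D" and f: "f \<in> C"
  shows "e \<in> C \<longleftrightarrow> f \<in> D"
proof
  assume "e \<in> C"
  then obtain x where "x \<in> C" "x \<in> D" "x \<noteq> e"
    using other_common_element[OF C D _ e] by blast
  with sub show "f \<in> D" by blast
next
  assume "f \<in> D"
  then obtain x where "x \<in> C" "x \<in> D" "x \<noteq> f"
    using other_common_element[OF C D f] by blast
  with sub show "e \<in> C" by blast
qed

text \<open>Extend \<open>C - {e}\<close> to a base: the fundamental cocircuit of \<open>f\<close>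
  meets it only in \<open>f\<close>, hence meets \<open>C\<close> at most in \<open>e\<close> and
  \<open>f\<close>.\<close>

lemma cocircuit_meeting_circuit_in_pair:
  assumes C: "C \<in> circuits E \<I>" and e: "e \<in> C" "f \<in> C" "e \<noteq> f"
  obtains D where "D \<in> cocircuits E \<I>" "C \<inter> D = {e, f}"
proof -
  have "C - {e} \<in> \<I>"
    using circuit_psubset_indep[OF C, of "C - {e}"] e by auto
  then obtain B where B: "B \<in> bases \<I>" "C - {e} \<subseteq> B"
    by (rule indep_extends_to_base)
  have "f \<in> B"
    using B(2) e by blast
  then obtain D where D: "D \<in> cocircuits E \<I>" "D \<inter> B = {f}"
    using fundamental_cocircuit[OF B(1)] by metis
  with B have sub: "C \<inter> D \<subseteq> {f, e}"
    by blast
  moreover have "f \<in> D"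
    using D by blast
  ultimately have "e \<in> D"
    using mem_circuit_iff_mem_cocircuit[OF C D(1)] e by blast
  with sub \<open>f \<in> D\<close> D e that show thesis by blast
qed

text \<open>The dual construction: a fundamental circuit of \<open>f\<close> for a base avoiding
  \<open>D - {e}\<close>.\<close>

lemma circuit_meeting_cocircuit_in_pair:
  assumes D: "D \<in> cocircuits E \<I>" and e: "e \<in> D" "f \<in> D" "e \<noteq> f"
  obtains C where "C \<in> circuits E \<I>" "C \<inter> D = {e, f}"
proof -
  obtain B where B: "B \<in> bases \<I>" "B \<inter> (D - {e}) = {}"
    using cocircuit_remove_avoids_base[OF D e(1)] .
  then obtain C where C: "C \<in> circuits E \<I>" "f \<in> C" "C \<subseteq> insert f B"
    using fundamental_circuit[OF B(1), of f] cocircuit_subset_carrier[OF D] e by blast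
  with B have sub: "C \<inter> D \<subseteq> {e, f}"
    by blast
  with C e have "e \<in> C"
    using mem_circuit_iff_mem_cocircuit[OF C(1) D] by blast
  with sub C e that show thesis by blast
qed

section \<open>Pivoting and separation by cocircuits\<close>

text \<open>
  The combination of \<open>d D\<^sub>1\<close> and \<open>d D\<^sub>2\<close> that vanishes at \<open>x\<close> is supported on a cocircuit, the
  fundamental cocircuit of \<open>p\<close> for the basis with \<open>f\<close> replaced by \<open>x\<close>.
\<close>

lemma pivot_cocircuit:
  assumes D1: "D1 \<in> cocircuits E \<I>" "D1 \<inter> B = {p}"
    and D2: "D2 \<in> cocircuits E \<I>" "D2 \<inter> B = {f}"
    and B': "insert x (B - {f}) \<in> bases \<I>" and x: "x \<in> D2" "x \<notin> B" and "p \<noteq> f"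
  obtains D where "D \<in> cocircuits E \<I>"
    "\<And>y. y \<in> E \<Longrightarrow> y \<in> D \<longleftrightarrow> dval D1 y * dval D2 x \<noteq> dval D1 x * dval D2 y"
proof -
  define B' where "B' = insert x (B - {f})"
  define w where "w y = dval D1 y * dval D2 x - dval D1 x * dval D2 y" for y
  have p: "p \<in> D1" "p \<in> B" "p \<in> B'" "p \<notin> D2" "p \<noteq> x"
    using D1 D2 x \<open>p \<noteq> f\<close> by (auto simp: B'_def)
  have B'base: "B' \<in> bases \<I>"
    using B' by (simp add: B'_def)
  obtain D where D: "D \<in> cocircuits E \<I>" "D \<inter> B' = {p}"
    using fundamental_cocircuit[OF B'base p(3)] .
  have "dval D1 p \<noteq> 0" "dval D2 p = 0" "dval D2 x \<noteq> 0"
    using p x dval_eq_0_iff[OF D1(1)] dval_eq_0_iff[OF D2(1)] by blast+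
  then have wp: "w p \<noteq> 0"
    by (simp add: w_def)
  have "y \<in> D \<longleftrightarrow> w y \<noteq> 0" if y: "y \<in> E" for y
  proof (cases "y \<in> B'")
    case True
    then have "y \<in> D \<longleftrightarrow> y = p"
      using D by blast
    moreover have "w y = 0" if "y \<noteq> p"
    proof (cases "y = x")
      case False
      with True that have "y \<notin> D1" "y \<notin> D2"
        using D1 D2 by (auto simp: B'_def)
      then show ?thesis
        by (simp add: w_def dval_def)
    qed (simp add: w_def)
    ultimately show ?thesis
      using wp by blast
  next
    case False
    then obtain C where C: "C \<in> circuits E \<I>" "y \<in> C" "C \<subseteq> insert y B'"
      using fundamental_circuit[OF B'base y] by blast
    have yx: "y \<noteq> x" "y \<noteq> p"
      using False p by (auto simp: B'_def)
    \<comment> \<open>\<open>w\<close> inherits orthogonality to \<open>C\<close> and vanishes at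
      \<open>x\<close>, which leaves a relation between \<open>p\<close> and \<open>y\<close>
      alone.\<close>
    have "(\<Sum>e\<in>{p, x, y}. cval C e * dval D1 e) = 0"
      using C D1 by (intro orthogonal) (auto simp: B'_def)
    moreover have "(\<Sum>e\<in>{p, x, y}. cval C e * dval D2 e) = 0"
      using C D2 by (intro orthogonal) (auto simp: B'_def)
    moreover have "cval C p * w p + cval C y * w y =
        dval D2 x * (\<Sum>e\<in>{p, x, y}. cval C e * dval D1 e) -
        dval D1 x * (\<Sum>e\<in>{p, x, y}. cval C e * dval D2 e)"
      using yx p(5) by (simp add: w_def algebra_simps)
    ultimately have "cval C p * w p + cval C y * w y = 0"
      by simp
    then have "w y \<noteq> 0 \<longleftrightarrow> p \<in> C"
      using wp cval_eq_0_iff[OF C(1)] C(2) by (metis add.right_neutral add.left_neutral mult_eq_0_iff)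
    also have "\<dots> \<longleftrightarrow> y \<in> D"
    proof (rule mem_circuit_iff_mem_cocircuit[OF C(1) D(1)])
      show "C \<inter> D \<subseteq> {p, y}" "p \<in> D" "y \<in> C"
        using C D by blast+
    qed
    finally show ?thesis by simp
  qed
  with D(1) that show thesis
    by (simp add: w_def)
qed

text \<open>
  If all these cocircuits \<open>G\<close> failed, a combination of the fundamental circuits of \<open>q\<close> and \<open>r\<close>
  would be supported on \<open>C - {p}\<close>, which is independent.
\<close>

lemma separating_cocircuit:
  assumes B: "B \<in> bases \<I>" and D: "D \<in> cocircuits E \<I>" "B \<inter> D = {p}"
    and C: "C \<in> circuits E \<I>" "C - D \<subseteq> B" "p \<in> C"
    and q: "q \<in> C \<inter> D" "q \<noteq> p" and r: "r \<in> C \<inter> D" "r \<noteq> p" and "q \<noteq> r"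
  obtains f G where "f \<in> B - C" "G \<in> cocircuits E \<I>" "G \<inter> B = {f}"
    "\<And>x. x \<in> G \<Longrightarrow> insert x (B - {f}) \<in> bases \<I>"
    "dval G q * dval D r \<noteq> dval G r * dval D q"
proof (rule ccontr)
  note separated = that
  assume contr: "\<not> thesis"
  have qr: "q \<notin> B" "r \<notin> B" "q \<in> E" "r \<in> E" and p: "p \<in> B" "p \<in> D"
    using D q r circuit_subset_carrier[OF C(1)] by auto
  obtain C1 where C1: "C1 \<in> circuits E \<I>" "q \<in> C1" "C1 \<subseteq> insert q B"
    using fundamental_circuit[OF B qr(3,1)] .
  obtain C2 where C2: "C2 \<in> circuits E \<I>" "r \<in> C2" "C2 \<subseteq> insert r B"
    using fundamental_circuit[OF B qr(4,2)] .
  have sub1: "C1 \<inter> D \<subseteq> {p, q}" and sub2: "C2 \<inter> D \<subseteq> {p, r}"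
    using C1 C2 D by blast+
  have pC: "p \<in> C1" "p \<in> C2"
    using mem_circuit_iff_mem_cocircuit[OF C1(1) D(1) sub1]
      mem_circuit_iff_mem_cocircuit[OF C2(1) D(1) sub2] p q r C1 C2 by blast+
  \<comment> \<open>The combination of the two circuit vectors that vanishes at
    \<open>p\<close>.\<close>
  define v where "v y = cval C1 y * cval C2 p - cval C2 y * cval C1 p" for y
  have v_off: "v f = 0" if f: "f \<in> B - C" for f
  proof -
    obtain G where G: "G \<in> cocircuits E \<I>" "G \<inter> B = {f}"
      "\<And>x. x \<in> G \<Longrightarrow> insert x (B - {f}) \<in> bases \<I>"
      using fundamental_cocircuit[OF B, of f] f by blast
    then have eq: "dval G q * dval D r = dval G r * dval D q"
      using contr separated[OF f G(1,2,3)] by blast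
    have "cval C1 f * dval G f + cval C1 q * dval G q = 0"
      "cval C2 f * dval G f + cval C2 r * dval G r = 0"
      using C1 C2 G f q r by (intro orthogonal_pair; auto)+
    moreover have "cval C1 p * dval D p + cval C1 q * dval D q = 0"
      "cval C2 p * dval D p + cval C2 r * dval D r = 0"
      using C1 C2 D q r sub1 sub2 by (intro orthogonal_pair; auto)+
    \<comment> \<open>The four relations turn the left side into \<open>cval C1 q * cval C2 r *
      (dval G q * dval D r - dval G r * dval D q)\<close>.\<close>
    ultimately have "v f * dval G f * dval D p = 0"
      using eq unfolding v_def by algebra
    then show ?thesis
      using dval_eq_0_iff[OF G(1)] dval_eq_0_iff[OF D(1)] G(2) p by auto
  qed
  have v_supp: "v y = 0" if "y \<notin> C \<or> y = p" for y
  proof (cases "y \<in> B \<or> y = p")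
    case True
    with v_off[of y] that show ?thesis
      by (auto simp: v_def)
  next
    case False
    with that q r have "y \<notin> C1" "y \<notin> C2"
      using C1 C2 by auto
    then show ?thesis
      by (simp add: v_def cval_def)
  qed
  \<comment> \<open>This cocircuit stands in for the independence of \<open>C - {p}\<close>: it
    meets the support of \<open>v\<close> at most in \<open>q\<close>, so orthogonality forces
    \<open>v q = 0\<close>, although \<open>q\<close> lies on \<open>C1\<close> and not on
    \<open>C2\<close>.\<close>
  obtain G where G: "G \<in> cocircuits E \<I>" "C \<inter> G = {p, q}"
    using cocircuit_meeting_circuit_in_pair[OF C(1), of p q] C q by blast
  define S where "S = (C1 \<union> C2) \<inter> G"
  have S: "finite S" "C1 \<inter> G \<subseteq> S" "C2 \<inter> G \<subseteq> S" "q \<in> S"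
    using finite_circuit_Int_cocircuit[OF C1(1) G(1)] finite_circuit_Int_cocircuit[OF C2(1) G(1)] G C1(2)
    by (auto simp: S_def Int_Un_distrib2)
  have "(\<Sum>e\<in>S. v e * dval G e) =
      cval C2 p * (\<Sum>e\<in>S. cval C1 e * dval G e) - cval C1 p * (\<Sum>e\<in>S. cval C2 e * dval G e)"
    by (simp add: v_def sum_distrib_left sum_subtractf algebra_simps)
  also have "\<dots> = 0"
    using orthogonal[OF C1(1) G(1) S(1,2)] orthogonal[OF C2(1) G(1) S(1,3)] by simp
  also have "(\<Sum>e\<in>S. v e * dval G e) = (\<Sum>e\<in>{q}. v e * dval G e)"
  proof (intro sum.mono_neutral_right ballI)
    fix e assume e: "e \<in> S - {q}"
    then show "v e * dval G e = 0"
      using v_supp[of e] G(2) by (auto simp: S_def)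
  qed (use S in auto)
  finally have "v q * dval G q = 0"
    by simp
  moreover have "q \<notin> C2"
    using C2 qr \<open>q \<noteq> r\<close> by blast
  then have "v q = cval C1 q * cval C2 p"
    by (simp add: v_def cval_def)
  ultimately show False
    using C1(2) G(2) pC
    by (auto simp: cval_eq_0_iff[OF C1(1)] cval_eq_0_iff[OF C2(1)] dval_eq_0_iff[OF G(1)])
qed

text \<open>Unless \<open>C\<close> or \<open>D\<close> already works, take a base that meets
  \<open>D\<close> only in \<open>f\<close> and contains \<open>C - D\<close>. If the fundamental
  cocircuit \<open>G\<close> of \<open>e\<close> contains \<open>g\<close>, the fundamental circuit
  of \<open>g\<close> passes through all three edges; otherwise pivoting \<open>D\<close> by
  \<open>G\<close> gives such a cocircuit.\<close>

lemma triple_in_circuit_or_cocircuit: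
  assumes C: "C \<in> circuits E \<I>" "e \<in> C" "f \<in> C" and D: "D \<in> cocircuits E \<I>" "f \<in> D" "g \<in> D"
  shows "(\<exists>C'\<in>circuits E \<I>. {e, f, g} \<subseteq> C') \<or> (\<exists>D'\<in>cocircuits E \<I>. {e, f, g} \<subseteq> D')"
proof (cases "g \<in> C \<or> e \<in> D")
  case True
  with C D show ?thesis by blast
next
  case False
  obtain B where B: "B \<in> bases \<I>" "B \<inter> D = {f}" "C - D \<subseteq> B"
    using base_through_circuit_and_cocircuit[OF C(1) D(1) C(3) D(2)] .
  have e: "e \<in> B" "e \<noteq> f" and g: "g \<in> E" "g \<notin> B" "f \<in> B" "f \<in> E" "e \<in> E"
    using B C(2,3) D(2,3) False cocircuit_subset_carrier[OF D(1)] circuit_subset_carrier[OF C(1)]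
    by auto
  obtain G where G: "G \<in> cocircuits E \<I>" "G \<inter> B = {e}"
    "\<And>x. x \<in> G \<Longrightarrow> insert x (B - {e}) \<in> bases \<I>"
    using fundamental_cocircuit[OF B(1) e(1)] by blast
  \<comment> \<open>The pivot edge: being in \<open>G\<close> and different from \<open>e\<close>,
    it lies outside \<open>B\<close>, hence in \<open>D\<close>.\<close>
  obtain x where x: "x \<in> C" "x \<in> G" "x \<noteq> e"
    using other_common_element[OF C(1) G(1) C(2)] G(2) by blast
  then have xB: "x \<notin> B" "x \<in> D"
    using G B by blast+
  show ?thesis
  proof (cases "g \<in> G")
    case True
    obtain C' where C': "C' \<in> circuits E \<I>" "g \<in> C'" "C' \<subseteq> insert g B"
      using fundamental_circuit[OF B(1) g(1,2)] .
    have "f \<in> C'"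
      using mem_circuit_iff_mem_cocircuit[OF C'(1) D(1), of f g] C' B D by blast
    moreover have "e \<in> C'"
      using mem_circuit_iff_mem_cocircuit[OF C'(1) G(1), of e g] C' G(2) True by blast
    ultimately show ?thesis
      using C' by blast
  next
    case False
    have "D \<inter> B = {f}"
      using B(2) by blast
    then obtain D' where D': "D' \<in> cocircuits E \<I>"
      "\<And>y. y \<in> E \<Longrightarrow> y \<in> D' \<longleftrightarrow> dval D y * dval G x \<noteq> dval D x * dval G y"
      using pivot_cocircuit[OF D(1) _ G(1,2) G(3)[OF x(2)] x(2) xB(1) e(2)[symmetric]] by blast
    have "e \<notin> D" "e \<in> G" "f \<notin> G"
      using \<open>\<not> (g \<in> C \<or> e \<in> D)\<close> G(2) e(2) g(3) by auto
    then have "dval D e = 0" "dval G e \<noteq> 0" "dval D f \<noteq> 0" "dval G f = 0"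
      "dval D g \<noteq> 0" "dval G g = 0" "dval D x \<noteq> 0" "dval G x \<noteq> 0"
      using False x xB D by (simp_all add: dval_eq_0_iff[OF D(1)] dval_eq_0_iff[OF G(1)])
    then have "e \<in> D'" "f \<in> D'" "g \<in> D'"
      using D'(2) g by simp_all
    with D' show ?thesis by blast
  qed
qed

end

section \<open>Two paintings over the field with three elements\<close>

text \<open>For \<open>a\<close> other than \<open>1\<close>, the field is exhausted by
  \<open>0\<close>, \<open>1\<close> and \<open>a\<close>, and \<open>a * a\<close> can be neither
  \<open>0\<close> nor \<open>a\<close>. The size of the field enters the argument only through this
  fact.\<close>

lemma square_eq_1_if_card_3:
  fixes a :: "'k::field"
  assumes "CARD('k) = 3" "a \<noteq> 0"
  shows "a * a = 1"
proof (cases "a = 1")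
  case False
  have "finite (UNIV :: 'k set)"
    using assms(1) by (simp add: card_ge_0_finite)
  moreover have "card {0, 1, a} = 3"
    using False assms(2) by auto
  ultimately have "{0, 1, a} = UNIV"
    using assms(1) by (metis card_subset_eq subset_UNIV)
  then have "a * a \<in> {0, 1, a}"
    by simp
  with False assms(2) show ?thesis
    by auto
qed simp

locale two_paintings = painted_matroid E \<I> c d + other: painted_matroid E \<I> c' d'
  for E :: "'a set" and \<I> :: "'a set set" and c d c' d' :: "'a set \<Rightarrow> 'a \<Rightarrow> 'k::field" +
  assumes card_3: "CARD('k) = 3"
begin

text \<open>Nonzero elements are their own inverses, so on a circuit \<open>C\<close> this product
  is also the quotient \<open>c' C e / c C e\<close>.\<close>

definition \<sigma> :: "'a set \<Rightarrow> 'a \<Rightarrow> 'k" where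
  "\<sigma> C e = c C e * c' C e"

definition \<tau> :: "'a set \<Rightarrow> 'a \<Rightarrow> 'k" where
  "\<tau> D e = d D e * d' D e"

lemma \<sigma>_square: "C \<in> circuits E \<I> \<Longrightarrow> e \<in> C \<Longrightarrow> \<sigma> C e * \<sigma> C e = 1"
  using painting other.painting
  by (intro square_eq_1_if_card_3 card_3) (simp add: \<sigma>_def painting_def)

lemma \<tau>_square: "D \<in> cocircuits E \<I> \<Longrightarrow> e \<in> D \<Longrightarrow> \<tau> D e * \<tau> D e = 1"
  using painting other.painting
  by (intro square_eq_1_if_card_3 card_3) (simp add: \<tau>_def painting_def)

lemma c'_eq: "C \<in> circuits E \<I> \<Longrightarrow> e \<in> C \<Longrightarrow> c' C e = \<sigma> C e * c C e"
  using square_eq_1_if_card_3[OF card_3, of "c C e"] painting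
  by (simp add: \<sigma>_def painting_def algebra_simps)

lemma d'_eq: "D \<in> cocircuits E \<I> \<Longrightarrow> e \<in> D \<Longrightarrow> d' D e = \<tau> D e * d D e"
  using square_eq_1_if_card_3[OF card_3, of "d D e"] painting
  by (simp add: \<tau>_def painting_def algebra_simps)

text \<open>The difference of the two orthogonality relations rules out a single exceptional edge.\<close>

lemma another_with_same_sign:
  assumes C: "C \<in> circuits E \<I>" and D: "D \<in> cocircuits E \<I>"
    and p: "p \<in> C \<inter> D" and q: "q \<in> C \<inter> D"
    and ne: "\<sigma> C p * \<tau> D p \<noteq> \<sigma> C q * \<tau> D q"
  obtains r where "r \<in> C \<inter> D" "r \<noteq> q" "\<sigma> C r * \<tau> D r = \<sigma> C q * \<tau> D q"
proof (rule ccontr)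
  note other_sign = that
  assume contr: "\<not> thesis"
  define \<kappa> where "\<kappa> x = \<sigma> C x * \<tau> D x" for x
  have sq: "\<kappa> x = 1 \<or> \<kappa> x = - 1" if "x \<in> C \<inter> D" for x
  proof -
    have "\<kappa> x * \<kappa> x = (\<sigma> C x * \<sigma> C x) * (\<tau> D x * \<tau> D x)"
      by (simp add: \<kappa>_def)
    also have "\<dots> = 1"
      using \<sigma>_square[OF C, of x] \<tau>_square[OF D, of x] that by simp
    finally show ?thesis
      by (simp only: square_eq_1_iff)
  qed
  have others: "\<kappa> x = \<kappa> p" if "x \<in> C \<inter> D" "x \<noteq> q" for x
  proof -
    have "\<kappa> x \<noteq> \<kappa> q"
      using contr other_sign[OF that] by (auto simp: \<kappa>_def)
    with sq[OF that(1)] sq[OF p] sq[OF q] ne show ?thesis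
      by (auto simp: \<kappa>_def[symmetric])
  qed
  have "(\<Sum>x\<in>C \<inter> D. (\<kappa> x - \<kappa> p) * (c C x * d D x)) =
      (\<Sum>x\<in>C \<inter> D. c' C x * d' D x) - \<kappa> p * (\<Sum>x\<in>C \<inter> D. c C x * d D x)"
    unfolding sum_distrib_left sum_subtractf[symmetric]
    by (intro sum.cong) (auto simp: c'_eq[OF C] d'_eq[OF D] \<kappa>_def algebra_simps)
  also have "\<dots> = 0"
    using painting other.painting C D by (simp add: painting_def)
  also have "(\<Sum>x\<in>C \<inter> D. (\<kappa> x - \<kappa> p) * (c C x * d D x)) =
      (\<Sum>x\<in>{q}. (\<kappa> x - \<kappa> p) * (c C x * d D x))"
    using finite_circuit_Int_cocircuit[OF C D] others q by (intro sum.mono_neutral_right) auto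
  finally have "(\<kappa> q - \<kappa> p) * (c C q * d D q) = 0"
    by simp
  then show False
    using ne painting C D q by (auto simp: \<kappa>_def painting_def)
qed

section \<open>Constancy of the sign product\<close>

lemma sign_product_constant:
  assumes "C \<in> circuits E \<I>" "D \<in> cocircuits E \<I>" "p \<in> C \<inter> D" "q \<in> C \<inter> D"
  shows "\<sigma> C p * \<tau> D p = \<sigma> C q * \<tau> D q"
  using assms
proof (induction "card (C \<inter> D)" arbitrary: C D p q rule: less_induct)
  case less
  note C = less.prems(1) and D = less.prems(2) and p = less.prems(3) and q = less.prems(4)
  have fin: "finite (C \<inter> D)"
    using finite_circuit_Int_cocircuit[OF C D] .
  show ?case
  proof (rule ccontr)
    assume ne: "\<sigma> C p * \<tau> D p \<noteq> \<sigma> C q * \<tau> D q"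
    \<comment> \<open>Together with \<open>s\<close> below, each sign occurs at least twice. The
      resulting bound of four makes every intersection with at most three edges smaller.\<close>
    obtain r where r: "r \<in> C \<inter> D" "r \<noteq> q" "\<sigma> C r * \<tau> D r = \<sigma> C q * \<tau> D q"
      using another_with_same_sign[OF C D p q ne] .
    obtain s where s: "s \<in> C \<inter> D" "s \<noteq> p" "\<sigma> C s * \<tau> D s = \<sigma> C p * \<tau> D p"
      using another_with_same_sign[OF C D q p ne[symmetric]] .
    have "p \<noteq> q" "p \<noteq> r" "s \<noteq> q" "s \<noteq> r"
      using ne r s by auto
    then have "card {p, q, r, s} = 4"
      using r s by simp
    moreover have "card {p, q, r, s} \<le> card (C \<inter> D)"
      using p q r s fin by (intro card_mono) auto
    ultimately have card4: "4 \<le> card (C \<inter> D)"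
      by simp
    obtain B where B: "B \<in> bases \<I>" "B \<inter> D = {p}" "C - D \<subseteq> B"
      using base_through_circuit_and_cocircuit[OF C D, of p] p by blast
    obtain f G where f: "f \<in> B - C" and G: "G \<in> cocircuits E \<I>" "G \<inter> B = {f}"
      "\<And>x. x \<in> G \<Longrightarrow> insert x (B - {f}) \<in> bases \<I>"
      and sep: "dval G q * dval D r \<noteq> dval G r * dval D q"
      using separating_cocircuit[OF B(1) D B(2) C B(3), of q r] p q r \<open>p \<noteq> q\<close> \<open>p \<noteq> r\<close> by blast
    have "q \<in> G \<or> r \<in> G"
      using sep by (auto simp: dval_def split: if_splits)
    \<comment> \<open>\<open>q\<close> and \<open>r\<close> carry the same sign, so either may serve
      as the exceptional edge \<open>y\<close> while the other, lying in \<open>G\<close>, is the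
      pivot \<open>x\<close>.\<close>
    then obtain x y where xy: "x \<in> G" "{x, y} = {q, r}"
      by blast
    then have y: "y \<in> C \<inter> D" "y \<noteq> p" "\<sigma> C p * \<tau> D p \<noteq> \<sigma> C y * \<tau> D y"
      and x: "x \<in> C \<inter> D" "x \<noteq> p"
      using q r ne \<open>p \<noteq> q\<close> \<open>p \<noteq> r\<close> by (auto simp: doubleton_eq_iff)
    have sep': "dval D y * dval G x \<noteq> dval D x * dval G y"
      using xy sep by (auto simp: doubleton_eq_iff mult.commute)
    have mem: "p \<in> B" "p \<in> C" "p \<in> D" "p \<in> E" "x \<notin> B" "x \<in> E" "y \<notin> B" "y \<in> E" "p \<noteq> f"
      using B p x y f circuit_subset_carrier[OF C] by blast+
    have "D \<inter> B = {p}"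
      using B(2) by blast
    then obtain D' where D': "D' \<in> cocircuits E \<I>"
      "\<And>e. e \<in> E \<Longrightarrow> e \<in> D' \<longleftrightarrow> dval D e * dval G x \<noteq> dval D x * dval G e"
      using pivot_cocircuit[OF D _ G(1,2) G(3)[OF xy(1)] xy(1) mem(5) mem(9)] by blast
    have D'sub: "D' \<subseteq> D \<union> G"
    proof
      fix e assume "e \<in> D'"
      then have "dval D e * dval G x \<noteq> dval D x * dval G e"
        using D' cocircuit_subset_carrier by blast
      then show "e \<in> D \<union> G"
        by (auto simp: dval_def split: if_splits)
    qed
    have yD': "y \<in> D'"
      using D'(2) mem sep' by blast
    have "p \<notin> G"
      using G(2) mem by blast
    then have pD': "p \<in> D'"
      using D'(2)[OF mem(4)] mem(3) xy(1) dval_eq_0_iff[OF G(1)] dval_eq_0_iff[OF D]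
      by (metis mult_eq_0_iff)
    have xD': "x \<notin> D'"
      using D'(2) mem by blast
    obtain C' where C': "C' \<in> circuits E \<I>" "y \<in> C'" "C' \<subseteq> insert y B"
      using fundamental_circuit[OF B(1) mem(8,7)] .
    have C'D: "C' \<inter> D \<subseteq> {p, y}"
      using C' B by blast
    then have pC': "p \<in> C'"
      using mem_circuit_iff_mem_cocircuit[OF C'(1) D] C' y mem by blast
    \<comment> \<open>An edge of \<open>C\<close> in \<open>D'\<close> but not in \<open>D\<close>
      would lie in \<open>G\<close> and \<open>B\<close>, so it would be \<open>f\<close>, which is
      not in \<open>C\<close>. Since \<open>x\<close> is lost, \<open>C \<inter> D'\<close> is
      strictly smaller.\<close>
    have "e \<in> D" if "e \<in> C" "e \<in> D'" for e
    proof (rule ccontr)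
      assume "e \<notin> D"
      with that D'sub B(3) have "e \<in> G \<inter> B"
        by blast
      with G(2) f that show False
        by simp
    qed
    then have "C \<inter> D' \<subset> C \<inter> D"
      using x(1) xD' by auto
    then have "card (C \<inter> D') < card (C \<inter> D)"
      by (rule psubset_card_mono[OF fin])
    then have eq1: "\<sigma> C p * \<tau> D' p = \<sigma> C y * \<tau> D' y"
      using less.hyps C D' pD' yD' mem y by blast
    have "C' \<inter> D' \<subseteq> {p, y, f}"
      using C' D'sub B(2) G(2) by blast
    then have "card (C' \<inter> D') \<le> card {p, y, f}"
      by (intro card_mono) auto
    also have "\<dots> < card (C \<inter> D)"
      using card4 card_insert_le_m1[of 3 "{y, f}" p] card_insert_le_m1[of 2 "{f}" y] by simp
    finally have eq2: "\<sigma> C' p * \<tau> D' p = \<sigma> C' y * \<tau> D' y"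
      using less.hyps[of C' D' p y] C' D' pD' yD' pC' by blast
    have "card (C' \<inter> D) \<le> card {p, y}"
      using C'D by (intro card_mono) auto
    also have "\<dots> < card (C \<inter> D)"
      using card4 y(2) by simp
    finally have eq3: "\<sigma> C' p * \<tau> D p = \<sigma> C' y * \<tau> D y"
      using less.hyps[of C' D p y] C' D pC' mem y by blast
    \<comment> \<open>In the product of the three equations each sign of \<open>C'\<close> and
      \<open>D'\<close> occurs twice and cancels.\<close>
    have "\<sigma> C p * \<tau> D p = \<sigma> C y * \<tau> D y"
      using eq1 eq2 eq3 \<sigma>_square[OF C'(1) pC'] \<sigma>_square[OF C'(1,2)]
        \<tau>_square[OF D'(1) pD'] \<tau>_square[OF D'(1) yD'] by algebra
    with y show False by simp
  qed
qed

section \<open>From signs of pairs to one sign per edge\<close>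

lemma circuit_sign_eq_cocircuit_sign:
  assumes C: "C \<in> circuits E \<I>" "e \<in> C" "f \<in> C" and D: "D \<in> cocircuits E \<I>" "e \<in> D" "f \<in> D"
  shows "\<sigma> C e * \<sigma> C f = \<tau> D e * \<tau> D f"
proof -
  have "\<sigma> C e * \<tau> D e = \<sigma> C f * \<tau> D f"
    using sign_product_constant C D by blast
  then show ?thesis
    using \<sigma>_square[OF C(1,2)] \<sigma>_square[OF C(1,3)] \<tau>_square[OF D(1,2)] \<tau>_square[OF D(1,3)]
    by algebra
qed

definition linked :: "'a \<Rightarrow> 'a \<Rightarrow> bool" where
  "linked e f \<longleftrightarrow> e = f \<or> (\<exists>C\<in>circuits E \<I>. e \<in> C \<and> f \<in> C)"

text \<open>The value \<open>1\<close> on the diagonal covers edges that lie on no circuit.\<close>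

definition \<rho> :: "'a \<Rightarrow> 'a \<Rightarrow> 'k" where
  "\<rho> e f = (if e = f then 1 else
     let C = SOME C. C \<in> circuits E \<I> \<and> e \<in> C \<and> f \<in> C in \<sigma> C e * \<sigma> C f)"

text \<open>A cocircuit meeting \<open>C\<close> exactly in \<open>e\<close> and \<open>f\<close>
  compares \<open>C\<close> with any other circuit through both edges, so the choice made in
  \<open>\<rho>\<close> does not matter.\<close>

lemma \<rho>_circuit:
  assumes C: "C \<in> circuits E \<I>" "e \<in> C" "f \<in> C"
  shows "\<rho> e f = \<sigma> C e * \<sigma> C f"
proof (cases "e = f")
  case True
  then show ?thesis
    using \<sigma>_square C by (simp add: \<rho>_def)
next
  case False
  define C' where "C' = (SOME C. C \<in> circuits E \<I> \<and> e \<in> C \<and> f \<in> C)"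
  have C': "C' \<in> circuits E \<I>" "e \<in> C'" "f \<in> C'"
    using someI[of "\<lambda>C. C \<in> circuits E \<I> \<and> e \<in> C \<and> f \<in> C" C] C by (auto simp: C'_def)
  obtain D where "D \<in> cocircuits E \<I>" "C \<inter> D = {e, f}"
    using cocircuit_meeting_circuit_in_pair[OF C False] .
  then have "\<sigma> C e * \<sigma> C f = \<tau> D e * \<tau> D f" "\<sigma> C' e * \<sigma> C' f = \<tau> D e * \<tau> D f"
    using circuit_sign_eq_cocircuit_sign C C' by blast+
  with False show ?thesis
    by (simp add: \<rho>_def C'_def)
qed

lemma linked_if_cocircuit:
  assumes "D \<in> cocircuits E \<I>" "e \<in> D" "f \<in> D"
  shows "linked e f"
proof (cases "e = f")
  case False
  then obtain C where "C \<in> circuits E \<I>" "C \<inter> D = {e, f}"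
    using circuit_meeting_cocircuit_in_pair[OF assms] by blast
  then show ?thesis
    unfolding linked_def by blast
qed (simp add: linked_def)

text \<open>\<open>\<rho>\<close> is read off circuits; a circuit meeting \<open>D\<close> exactly
  in the pair carries it over to cocircuits.\<close>

lemma \<rho>_cocircuit:
  assumes D: "D \<in> cocircuits E \<I>" "e \<in> D" "f \<in> D"
  shows "\<rho> e f = \<tau> D e * \<tau> D f"
proof (cases "e = f")
  case True
  then show ?thesis
    using \<tau>_square D by (simp add: \<rho>_def)
next
  case False
  obtain C where C: "C \<in> circuits E \<I>" "C \<inter> D = {e, f}"
    using circuit_meeting_cocircuit_in_pair[OF D False] .
  then have "\<rho> e f = \<sigma> C e * \<sigma> C f"
    by (intro \<rho>_circuit) auto
  also have "\<dots> = \<tau> D e * \<tau> D f"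
    using circuit_sign_eq_cocircuit_sign C D by blast
  finally show ?thesis .
qed

lemma linked_sym: "linked e f \<Longrightarrow> linked f e"
  by (auto simp: linked_def)

text \<open>Trading the circuit through \<open>f\<close> and \<open>g\<close> for a cocircuit puts
  all three edges on one circuit or cocircuit, where the sign of \<open>f\<close> appears
  squared.\<close>

lemma linked_trans_\<rho>:
  assumes ef: "linked e f" and fg: "linked f g"
  shows "linked e g \<and> \<rho> e g = \<rho> e f * \<rho> f g"
proof (cases "e = f \<or> f = g")
  case True
  with assms show ?thesis
    by (auto simp: \<rho>_def)
next
  case False
  with ef obtain C where C: "C \<in> circuits E \<I>" "e \<in> C" "f \<in> C"
    by (auto simp: linked_def)
  from False fg obtain C0 where C0: "C0 \<in> circuits E \<I>" "f \<in> C0" "g \<in> C0"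
    by (auto simp: linked_def)
  then obtain D where D: "D \<in> cocircuits E \<I>" "C0 \<inter> D = {f, g}"
    using cocircuit_meeting_circuit_in_pair[of C0 f g] False by blast
  then consider C' where "C' \<in> circuits E \<I>" "e \<in> C'" "f \<in> C'" "g \<in> C'"
    | D' where "D' \<in> cocircuits E \<I>" "e \<in> D'" "f \<in> D'" "g \<in> D'"
    using triple_in_circuit_or_cocircuit[OF C D(1), of g] by auto
  then show ?thesis
  proof cases
    case 1
    then show ?thesis
      using \<sigma>_square[OF 1(1,3)] by (auto simp: \<rho>_circuit linked_def mult.assoc)
  next
    case 2
    then show ?thesis
      using \<tau>_square[OF 2(1,3)] linked_if_cocircuit by (auto simp: \<rho>_cocircuit mult.assoc)
  qed
qed

definition rep :: "'a \<Rightarrow> 'a" where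
  "rep e = (SOME r. linked e r)"

definition z :: "'a \<Rightarrow> 'k" where
  "z e = \<rho> e (rep e)"

lemma linked_rep: "linked e (rep e)"
  unfolding rep_def by (rule someI[of _ e]) (simp add: linked_def)

text \<open>Linked edges are linked to the same edges, so the choice operator receives equal
  predicates.\<close>

lemma rep_eq: "linked e f \<Longrightarrow> rep e = rep f"
  unfolding rep_def using linked_trans_\<rho> linked_sym
  by (intro arg_cong[of _ _ Eps] ext) blast

lemma z_mult: "linked e f \<Longrightarrow> z e = \<rho> e f * z f"
  using linked_trans_\<rho>[OF _ linked_rep, of e f] rep_eq by (simp add: z_def)

lemma z_square: "z e * z e = 1"
proof (cases "e = rep e")
  case True
  then show ?thesis
    by (simp add: z_def \<rho>_def)
next
  case False
  then obtain C where C: "C \<in> circuits E \<I>" "e \<in> C" "rep e \<in> C"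
    using linked_rep[of e] by (auto simp: linked_def)
  then have "z e = \<sigma> C e * \<sigma> C (rep e)"
    by (simp add: z_def \<rho>_circuit)
  then show ?thesis
    using \<sigma>_square[OF C(1,2)] \<sigma>_square[OF C(1,3)] by algebra
qed

lemma equivalent: "equivalent_paintings E \<I> c d c' d'"
proof -
  \<comment> \<open>The global sign by which \<open>\<sigma> C\<close> differs from \<open>z\<close>
    on \<open>C\<close>, read off at an arbitrary edge; \<open>y\<close> does the same for
    cocircuits.\<close>
  define x where "x C = \<sigma> C (SOME e. e \<in> C) * z (SOME e. e \<in> C)" for C
  define y where "y D = \<tau> D (SOME e. e \<in> D) * z (SOME e. e \<in> D)" for D
  have z_nz: "z e \<noteq> 0" for e
    using z_square[of e] by auto
  have x: "x C \<noteq> 0 \<and> (\<forall>e\<in>C. c' C e = x C * z e * c C e)" if C: "C \<in> circuits E \<I>" for C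
  proof -
    define r where "r = (SOME e. e \<in> C)"
    have r: "r \<in> C"
      using circuit_nonempty[OF C] by (simp add: r_def some_in_eq)
    have "\<sigma> C e = x C * z e" if e: "e \<in> C" for e
    proof -
      have "z e = \<sigma> C e * \<sigma> C r * z r"
        using z_mult[of e r] \<rho>_circuit[OF C e r] C e r by (auto simp: linked_def)
      then show ?thesis
        using \<sigma>_square[OF C r] z_square[of r] unfolding x_def r_def[symmetric] by algebra
    qed
    moreover have "x C \<noteq> 0"
      using \<sigma>_square[OF C r] z_nz by (auto simp: x_def r_def[symmetric])
    ultimately show ?thesis
      using c'_eq[OF C] by simp
  qed
  have y: "y D \<noteq> 0 \<and> (\<forall>e\<in>D. d' D e = y D * d D e / z e)" if D: "D \<in> cocircuits E \<I>" for D
  proof -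
    define r where "r = (SOME e. e \<in> D)"
    have r: "r \<in> D"
      using cocircuit_nonempty[OF D] by (simp add: r_def some_in_eq)
    have "\<tau> D e * z e = y D" if e: "e \<in> D" for e
    proof -
      have "z e = \<tau> D e * \<tau> D r * z r"
        using z_mult[of e r] \<rho>_cocircuit[OF D e r] linked_if_cocircuit[OF D e r] by simp
      then show ?thesis
        using \<tau>_square[OF D e] unfolding y_def r_def[symmetric] by algebra
    qed
    then have "d' D e = y D * d D e / z e" if "e \<in> D" for e
      using d'_eq[OF D that] z_nz[of e] that by (simp add: field_simps)
    moreover have "y D \<noteq> 0"
      using \<tau>_square[OF D r] z_nz by (auto simp: y_def r_def[symmetric])
    ultimately show ?thesis
      by blast
  qed
  have "field_automorphism (id :: 'k \<Rightarrow> 'k)"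
    by (simp add: field_automorphism_def)
  with x y z_nz show ?thesis
    unfolding equivalent_paintings_def
    by (intro exI[of _ x] exI[of _ y] exI[of _ z] exI[of _ id]) auto
qed

end

theorem theorem5p5:
  fixes E :: "'a set" and \<I> :: "'a set set"
    and c c' d d' :: "'a set \<Rightarrow> 'a \<Rightarrow> 'k::field"
  assumes "matroid E \<I>"
    and "CARD('k) = 3"
    and "painting E \<I> c d"
    and "painting E \<I> c' d'"
  shows "equivalent_paintings E \<I> c d c' d'"
proof -
  interpret matroid E \<I> by fact
  interpret two_paintings E \<I> c d c' d'
    by unfold_locales (fact assms)+
  show ?thesis
    by (rule equivalent)
qed

end
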